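(* Let $W\in\mathbb{R}^{n\times k}$ be a normalized indicator matrix and suppose $n>4$. Let $V\in\mathbb{R}^{n\times k}$ have orthonormal columns and satisfy $$\left\|WW^T-VV^T\right\|_2\le\epsilon$$ with $\epsilon<2^{-k}/\sqrt{n}$. If $U\in\mathbb{R}^{k\times k}$ is the orthogonal matrix computed by the deterministic CPQR-based algorithm applied to $V^T$, then there exists a $k\times k$ permutation matrix $\widehat{\Pi}$ such that $$\|W\widehat{\Pi}-VU\|_F\le\epsilon k\sqrt{n}\left(2+2\sqrt{2}\right)+\mathcal{O}\left(\epsilon^2\right).$$
   Context: Notation: $[n]=\{1,\dots,n\}$; $\|\cdot\|_2$ is the spectral norm of a matrix and $\|\cdot\|_F$ the Frobenius norm; $B_{:,\mathcal{C}}$ is the submatrix of $B$ formed by the columns indexed by $\mathcal{C}$. The term $\mathcal{O}(\epsilon^2)$ is understood as $\epsilon\to0$ with $n,k$ fixed, i.e. it is bounded by $c\,\epsilon^2$ with $c$ depending only on $n$ and $k$. Normalized indicator matrix: given a partition $\mathcal{C}_1,\dots,\mathcal{C}_k$ of $[n]$ into nonempty clusters, the indicator matrix $W'\in\{0,1\}^{n\times k}$ has $W'_{ij}=1$ if $i\in\mathcal{C}_j$ and $0$ otherwise; the normalized indicator matrix $W$ is obtained from $W'$ by scaling each column to have unit $\ell_2$ norm. Column-pivoted QR factorization (CPQR): for $B\in\mathbb{R}^{k\times n}$, $k\le n$, of rank $k$, it is the factorization $B\Pi=Q[R_1\ R_2]$ computed by the Golub--Businger algorithm, with $\Pi$ an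 $n\times n$ permutation matrix, $Q$ a $k\times k$ orthogonal matrix, $R_1\in\mathbb{R}^{k\times k}$ upper triangular and $R_2\in\mathbb{R}^{k\times(n-k)}$. The permutation is chosen greedily: at each step the remaining column with largest Euclidean norm (after orthogonalization against previously chosen columns) is picked as the pivot, and the remaining columns are orthogonalized against it. Polar factorization: for $B\in\mathbb{R}^{k\times k}$, $B=UH$ with $U$ orthogonal and $H$ symmetric positive semidefinite. Deterministic algorithm applied to $V^T$: (1) compute the CPQR factorization $V^T\Pi=QR$; (2) let $\mathcal{C}\subset[n]$ be the original indices of the first $k$ columns selected by $\Pi$; (3) compute the polar factorization $(V^T)_{:,\mathcal{C}}=UH$. The matrix $U$ in the claim is this orthogonal polar factor. *)

theory Defs
  imports "HOL-Analysis.Analysis"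
begin

section \<open>Indices\<close>

text \<open>
  A finite linearly ordered type \<open>'n\<close> plays the role of \<open>[n]\<close> with \<open>n = CARD('n)\<close>; the order is
  needed for ``the first \<open>k\<close> columns'' and for triangularity. The list below enumerates the type
  increasingly, so that \<open>index_list ! s\<close> is the index with zero-based position \<open>s\<close>. A real
  \<open>m \<times> n\<close> matrix has type \<open>real^'n^'m\<close>.
\<close>

definition index_list :: "'a::{finite,linorder} list" where
  "index_list = sorted_list_of_set UNIV"


section \<open>Matrices\<close>

definition spectral_norm :: "real^'n^'m \<Rightarrow> real" where
  "spectral_norm A = onorm (\<lambda>x. A *v x)"

definition frobenius_norm :: "real^'n^'m \<Rightarrow> real" where
  "frobenius_norm A = sqrt (\<Sum>i\<in>UNIV. \<Sum>j\<in>UNIV. (A $ i $ j)\<^sup>2)"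

lemma frobenius_norm_eq_norm: "frobenius_norm A = norm A"
proof -
  have "(norm A)\<^sup>2 = (\<Sum>i\<in>UNIV. (norm (A $ i))\<^sup>2)"
    by (simp add: norm_vec_def L2_set_def sum_nonneg)
  also have "\<dots> = (\<Sum>i\<in>UNIV. \<Sum>j\<in>UNIV. (A $ i $ j)\<^sup>2)"
    by (simp add: norm_vec_def L2_set_def sum_nonneg)
  finally show ?thesis
    unfolding frobenius_norm_def by (metis norm_ge_zero real_sqrt_abs abs_of_nonneg)
qed

text \<open>
  Column \<open>j\<close> of \<open>perm_matrix \<pi>\<close> is the unit vector with index \<open>\<pi> j\<close>; hence column \<open>j\<close> of
  \<open>B ** perm_matrix \<pi>\<close> is column \<open>\<pi> j\<close> of \<open>B\<close>.
\<close>

definition perm_matrix :: "('n \<Rightarrow> 'n) \<Rightarrow> real^'n^'n" where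
  "perm_matrix \<pi> = (\<chi> i j. if i = \<pi> j then 1 else 0)"

definition permutation_matrix :: "real^'n^'n \<Rightarrow> bool" where
  "permutation_matrix P \<longleftrightarrow> (\<exists>\<pi>. bij \<pi> \<and> P = perm_matrix \<pi>)"

definition select_columns :: "real^'n^'m \<Rightarrow> ('k \<Rightarrow> 'n) \<Rightarrow> real^'k^'m" where
  "select_columns B \<sigma> = (\<chi> i j. B $ i $ \<sigma> j)"

definition positive_semidefinite :: "real^'k^'k \<Rightarrow> bool" where
  "positive_semidefinite H \<longleftrightarrow> transpose H = H \<and> (\<forall>x. 0 \<le> x \<bullet> (H *v x))"

definition polar_factorization :: "real^'k^'k \<Rightarrow> real^'k^'k \<Rightarrow> real^'k^'k \<Rightarrow> bool" where
  "polar_factorization B U H \<longleftrightarrow>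
     orthogonal_matrix U \<and> positive_semidefinite H \<and> B = U ** H"


section \<open>Normalized indicator matrices\<close>

definition indicator_matrix :: "('k \<Rightarrow> 'n set) \<Rightarrow> real^'k^'n" where
  "indicator_matrix C = (\<chi> i j. if i \<in> C j then 1 else 0)"

definition normalize_columns :: "real^'k^'n \<Rightarrow> real^'k^'n" where
  "normalize_columns A = (\<chi> i j. A $ i $ j / norm (column j A))"

definition normalized_indicator_matrix :: "real^'k^'n \<Rightarrow> bool" where
  "normalized_indicator_matrix W \<longleftrightarrow>
     (\<exists>C. disjoint_family C \<and> (\<forall>j. C j \<noteq> {}) \<and> (\<Union>j. C j) = UNIV \<and>
          W = normalize_columns (indicator_matrix C))"


section \<open>Column-pivoted QR factorization\<close>

text \<open>
  One elimination step: orthogonalize every column of \<open>A\<close> against column \<open>p\<close>. Columns chosen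
  earlier have already become zero and stay zero. (Division by zero cannot occur
  during the first \<open>k\<close> steps on a \<open>k \<times> n\<close> matrix of rank \<open>k\<close>.)
\<close>

definition orthogonalize_columns :: "real^'n^'k \<Rightarrow> 'n \<Rightarrow> real^'n^'k" where
  "orthogonalize_columns A p =
     (\<chi> i j. (column j A -
        ((column p A \<bullet> column j A) / (column p A \<bullet> column p A)) *\<^sub>R column p A) $ i)"

text \<open>
  \<open>greedy_pivots B ps A\<close>: starting from \<open>B\<close>, the greedy pivot rule can select the columns \<open>ps\<close>,
  in this order, leaving the residual matrix \<open>A\<close>. Ties may be broken arbitrarily.
\<close>

inductive greedy_pivots :: "real^'n^'k \<Rightarrow> 'n list \<Rightarrow> real^'n^'k \<Rightarrow> bool" for B where
  start: "greedy_pivots B [] B"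
| step: "greedy_pivots B ps A \<Longrightarrow> p \<notin> set ps \<Longrightarrow>
         (\<And>j. j \<notin> set ps \<Longrightarrow> norm (column j A) \<le> norm (column p A)) \<Longrightarrow>
         greedy_pivots B (ps @ [p]) (orthogonalize_columns A p)"

text \<open>
  The last condition but one says that the leading \<open>k \<times> k\<close> block \<open>R\<^sub>1\<close> of \<open>R = [R\<^sub>1 R\<^sub>2]\<close> is upper
  triangular. The order of the columns after the first \<open>k\<close>, which is not determined by the
  pivot rule, is left free, as are the signs of the columns of \<open>Q\<close>.
\<close>

definition cpqr ::
  "real^'n::{finite,linorder}^'k::{finite,linorder} \<Rightarrow> ('n \<Rightarrow> 'n) \<Rightarrow>
    real^'k::{finite,linorder}^'k::{finite,linorder} \<Rightarrow> real^'n::{finite,linorder}^'k::{finite,linorder} \<Rightarrow> bool" where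
  "cpqr B \<pi> Q R \<longleftrightarrow>
     CARD('k) \<le> CARD('n) \<and> bij \<pi> \<and> orthogonal_matrix Q \<and>
     B ** perm_matrix \<pi> = Q ** R \<and>
     (\<forall>s t. t < s \<and> s < CARD('k) \<longrightarrow> R $ (index_list ! s) $ (index_list ! t) = 0) \<and>
     (\<exists>A. greedy_pivots B (map \<pi> (take CARD('k) index_list)) A)"

text \<open>
  \<open>U\<close> is a possible output of the algorithm applied to \<open>B\<close>. The selected set of columns is
  \<open>\<pi> ` set (take k index_list)\<close>, and \<open>\<sigma>\<close> is the order in which these columns are put into a
  square matrix. Every order is admitted (in particular the increasing one and
  the pivot order): changing it turns \<open>B = U H\<close> into \<open>B P = (U P) (P\<^sup>T H P)\<close> for a permutation
  matrix \<open>P\<close>.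
\<close>

definition cpqr_polar_output ::
  "real^'n::{finite,linorder}^'k::{finite,linorder} \<Rightarrow> real^'k::{finite,linorder}^'k::{finite,linorder} \<Rightarrow> bool" where
  "cpqr_polar_output B U \<longleftrightarrow>
     (\<exists>\<pi> Q R \<sigma> H. cpqr B \<pi> Q R \<and>
        bij_betw \<sigma> (UNIV :: 'k set) (\<pi> ` set (take CARD('k) index_list)) \<and>
        polar_factorization (select_columns B \<sigma>) U H)"

end

theory Submission
  imports Defs
begin

text \<open>
  Write \<open>K = W W\<^sup>T - V V\<^sup>T\<close>, let \<open>v\<^sub>i\<close> be the columns of \<open>V\<^sup>T\<close>, and let \<open>d\<^sub>j\<close>
  be the nonzero value in column \<open>j\<close> of \<open>W\<close>, so \<open>d\<^sub>j \<ge> 1 / sqrt n\<close>.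

  The pivots hit every cluster exactly once. Two rows of \<open>W\<close> in the same cluster are equal, so
  \<open>V (v\<^sub>i - v\<^sub>l)\<close> is, up to sign, \<open>K (e\<^sub>i - e\<^sub>l)\<close> and \<open>v\<^sub>i\<close>, \<open>v\<^sub>l\<close> are
  within \<open>2 \<epsilon>\<close> of each other (\<open>same_cluster_columns_close\<close>). Orthogonalization is a contraction and
  annihilates the pivots, so a cluster that already contains a pivot only has residuals of norm at
  most \<open>2 \<epsilon>\<close>. On the other hand, as long as fewer than \<open>k\<close> pivots are chosen there is a unit
  vector \<open>x\<close> orthogonal to all of them, and \<open>\<parallel>V x\<parallel> = 1\<close> forces some residual to have norm at least
  \<open>1 / sqrt n\<close> (\<open>greedy_pivots_large_residual\<close>). Since \<open>2 \<epsilon> < 1 / sqrt n\<close>, the greedy rule always moves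
  to a new cluster (\<open>greedy_pivots_distinct_clusters\<close>).

  Let \<open>U H\<close> be the polar factorization of the matrix of selected \<open>v\<^sub>i\<close>, and let \<open>D = diag d\<close>, from
  now on with the \<open>d\<^sub>j\<close> listed in the order of the selected columns. Then \<open>H\<close> is close to \<open>D\<close>:
  \<open>H\<^sup>2\<close> is the Gram matrix of the selected \<open>v\<^sub>i\<close>, and \<open>D\<^sup>2\<close> is the Gram matrix of the corresponding
  rows of \<open>W\<close>, so \<open>F = H\<^sup>2 - D\<^sup>2\<close> is a submatrix of \<open>- K\<close>.
  The naive bound \<open>\<bar>F\<^sub>i\<^sub>j\<bar> \<le> \<epsilon>\<close> would cost a factor of order \<open>n\<close> instead of \<open>sqrt n\<close> in the end.
  What saves it is that \<open>K\<close> is a difference of two projectors: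
  \<open>K = K P + P K - K\<^sup>2\<close> with \<open>P = W W\<^sup>T\<close>, and the columns of \<open>P\<close> are themselves short, which gives
  \<open>\<bar>F\<^sub>i\<^sub>j\<bar> \<le> \<epsilon> (d\<^sub>i + d\<^sub>j) + \<epsilon>\<^sup>2\<close> (\<open>projector_difference_entry_bounds\<close>). With \<open>X = H - D\<close> one has
  \<open>(d\<^sub>i + d\<^sub>j) X\<^sub>i\<^sub>j = F\<^sub>i\<^sub>j - (X\<^sup>2)\<^sub>i\<^sub>j\<close>, so every entry of \<open>X\<close> is at most \<open>\<epsilon> + O(\<epsilon>\<^sup>2)\<close>
  (\<open>polar_factor_near_cluster_scaling\<close>).

  Finally, with \<open>\<Pi>\<close> the permutation matrix that lists the clusters in the order of the selected
  columns, \<open>d\<^sub>j\<close> times column \<open>j\<close> of \<open>W \<Pi> - V U\<close> equals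
  \<open>K e\<^sub>\<sigma>\<^sub>j + V U X e\<^sub>j\<close>, where \<open>\<sigma>\<^sub>j\<close> is the \<open>j\<close>-th selected index
  (\<open>polar_output_column_error\<close>). Dividing by \<open>d\<^sub>j\<close> and summing the squared norms
  of the \<open>k\<close> columns bounds the error by \<open>2 \<epsilon> k sqrt n + c \<epsilon>\<^sup>2\<close> with \<open>c = k n (1 + n k) / 2\<close>.
\<close>

section \<open>Matrix preliminaries\<close>

lemma norm_le_sqrt_card_times:
  fixes x :: "real^'k::finite"
  assumes "\<And>i. \<bar>x $ i\<bar> \<le> b"
  shows "norm x \<le> sqrt (real CARD('k)) * b"
proof -
  have "0 \<le> b"
    using assms abs_ge_zero order_trans by blast
  have "(norm x)\<^sup>2 = (\<Sum>i\<in>UNIV. (x $ i)\<^sup>2)"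
    by (simp add: norm_vec_def L2_set_def sum_nonneg)
  also have "\<dots> \<le> (\<Sum>i\<in>(UNIV::'k set). b\<^sup>2)"
    by (intro sum_mono) (use assms power_mono[OF assms abs_ge_zero, of _ 2] in simp)
  also have "\<dots> = (sqrt (real CARD('k)) * b)\<^sup>2"
    by (simp add: power_mult_distrib)
  finally show ?thesis
    using \<open>0 \<le> b\<close> by (meson mult_nonneg_nonneg of_nat_0_le_iff power2_le_imp_le real_sqrt_ge_zero)
qed

lemma frobenius_norm_le_of_columns:
  fixes A :: "real^'k::finite^'n::finite"
  assumes "\<And>j. norm (column j A) \<le> b"
  shows "frobenius_norm A \<le> sqrt (real CARD('k)) * b"
proof -
  have "frobenius_norm A = norm (\<chi> j. norm (column j A))"
  proof -
    have "(\<Sum>i\<in>UNIV. \<Sum>j\<in>UNIV. (A $ i $ j)\<^sup>2) = (\<Sum>j\<in>UNIV. (norm (column j A))\<^sup>2)"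
      by (subst sum.swap) (simp add: norm_vec_def L2_set_def sum_nonneg column_def)
    then show ?thesis
      by (simp add: frobenius_norm_def norm_vec_def L2_set_def)
  qed
  also have "\<dots> \<le> sqrt (real CARD('k)) * b"
    by (rule norm_le_sqrt_card_times) (use assms in simp)
  finally show ?thesis .
qed

lemma norm_orthonormal_columns_mult:
  fixes V :: "real^'k::finite^'n::finite"
  assumes "transpose V ** V = mat 1"
  shows "norm (V *v y) = norm y"
proof -
  have "(V *v y) \<bullet> (V *v y) = y \<bullet> ((transpose V ** V) *v y)"
    by (metis dot_lmul_matrix inner_commute matrix_vector_mul_assoc transpose_matrix_vector
        transpose_transpose)
  then show ?thesis
    using assms by (simp add: norm_eq_sqrt_inner)
qed

lemma spectral_norm_bound:
  fixes A :: "real^'n::finite^'m::finite"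
  assumes "spectral_norm A \<le> e"
  shows "norm (A *v x) \<le> e * norm x"
proof -
  have "norm (A *v x) \<le> spectral_norm A * norm x"
    unfolding spectral_norm_def
    by (rule onorm[OF matrix_vector_mul_bounded_linear])
  then show ?thesis
    using assms by (meson mult_right_mono norm_ge_zero order_trans)
qed

lemma column_matrix_mult: "column j (A ** B) = A *v column j B"
  by (simp add: vec_eq_iff column_def matrix_matrix_mult_def matrix_vector_mult_def)

lemma column_diff:
  fixes A :: "real^'n^'m"
  shows "column j (A - B) = column j A - column j B"
  by (simp add: vec_eq_iff column_def)

lemma matrix_diff_ldistrib:
  fixes A :: "real^'n::finite^'m::finite"
  shows "A ** (B - C) = A ** B - A ** C"
  by (simp add: vec_eq_iff matrix_matrix_mult_def right_diff_distrib sum_subtractf)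

lemma matrix_diff_rdistrib:
  fixes A :: "real^'n::finite^'m::finite"
  shows "(A - B) ** C = A ** C - B ** C"
  by (simp add: vec_eq_iff matrix_matrix_mult_def left_diff_distrib sum_subtractf)

section \<open>Cluster structure of a normalized indicator matrix\<close>

text \<open>
  This is the form in which indicator matrices enter the estimates: the partition is replaced by
  the map \<open>cl\<close> from indices to cluster labels, and of the scaling only the lower bound on \<open>d\<close> (from
  cluster sizes being at most \<open>n\<close>) and the orthonormality of the columns are kept.
\<close>

definition scaled_cluster_matrix :: "real^'k::finite^'n::finite \<Rightarrow> ('n \<Rightarrow> 'k) \<Rightarrow> ('k \<Rightarrow> real) \<Rightarrow> bool" where
  "scaled_cluster_matrix W cl d \<longleftrightarrow>
     (\<forall>i j. W $ i $ j = (if j = cl i then d j else 0)) \<and>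
     (\<forall>j. 1 / sqrt (real CARD('n)) \<le> d j) \<and> transpose W ** W = mat 1"

lemma normalized_indicator_matrix_clusters:
  fixes W :: "real^'k::finite^'n::finite"
  assumes "normalized_indicator_matrix W"
  obtains cl d where "scaled_cluster_matrix W cl d"
proof -
  obtain C where dis: "disjoint_family C" and ne: "\<And>j. C j \<noteq> {}" and cov: "(\<Union>j. C j) = UNIV"
    and W: "W = normalize_columns (indicator_matrix C)"
    using assms by (auto simp: normalized_indicator_matrix_def)
  define cl where "cl i = (THE j. i \<in> C j)" for i
  have cl: "i \<in> C j \<longleftrightarrow> j = cl i" for i j
  proof -
    have "\<exists>!j. i \<in> C j"
      using dis cov by (auto simp: disjoint_family_on_def)
    then show ?thesis
      unfolding cl_def by (metis the_equality)
  qed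
  have nrm: "norm (column j (indicator_matrix C)) = sqrt (real (card (C j)))" for j
    by (simp add: norm_vec_def L2_set_def column_def indicator_matrix_def if_distrib
        [where f="\<lambda>x. x\<^sup>2"] sum.If_cases cong: if_cong)
  define d where "d j = 1 / sqrt (real (card (C j)))" for j
  have Wij: "W $ i $ j = (if j = cl i then d j else 0)" for i j
    by (simp add: W normalize_columns_def nrm d_def) (simp add: indicator_matrix_def cl)
  have cpos: "0 < card (C j)" for j
    using ne by (simp add: card_gt_0_iff)
  have "1 / sqrt (real CARD('n)) \<le> d j" for j
    unfolding d_def using cpos[of j] by (intro divide_left_mono) (auto intro: card_mono)
  moreover have "transpose W ** W = mat 1"
  proof -
    have "(transpose W ** W) $ a $ b = mat 1 $ a $ b" for a b
    proof -
      have "(transpose W ** W) $ a $ b = (\<Sum>i\<in>UNIV. W $ i $ a * W $ i $ b)"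
        by (simp add: matrix_matrix_mult_def transpose_def)
      also have "\<dots> = (\<Sum>i\<in>UNIV. if i \<in> C a then (if a = b then d a * d a else 0) else 0)"
        by (intro sum.cong) (auto simp: Wij cl)
      also have "\<dots> = real (card (C a)) * (if a = b then d a * d a else 0)"
        by (simp add: sum.If_cases)
      also have "\<dots> = mat 1 $ a $ b"
        using ne[of a] by (cases "a = b") (simp_all add: mat_def d_def)
      finally show ?thesis .
    qed
    then show ?thesis
      by (simp add: vec_eq_iff)
  qed
  ultimately show ?thesis
    using that Wij unfolding scaled_cluster_matrix_def by blast
qed

section \<open>The greedy pivots visit every cluster once\<close>

lemma orthogonalize_against_norm_le:
  fixes p x :: "real^'k::finite"
  shows "norm (x - ((p \<bullet> x) / (p \<bullet> p)) *\<^sub>R p) \<le> norm x"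
proof -
  let ?y = "x - ((p \<bullet> x) / (p \<bullet> p)) *\<^sub>R p"
  have "p \<bullet> ?y = 0"
    by (cases "p = 0") (simp_all add: inner_diff_right)
  then have "?y \<bullet> x = ?y \<bullet> ?y"
    by (simp add: inner_diff_right inner_commute)
  then have "norm ?y * norm ?y \<le> norm ?y * norm x"
    by (metis norm_cauchy_schwarz power2_eq_square power2_norm_eq_inner)
  then show ?thesis
    by (metis mult_le_cancel_left_pos norm_ge_zero norm_zero order_less_le zero_less_norm_iff)
qed

lemma column_orthogonalize_columns:
  "column j (orthogonalize_columns A p) =
     column j A - ((column p A \<bullet> column j A) / (column p A \<bullet> column p A)) *\<^sub>R column p A"
  by (simp add: orthogonalize_columns_def vec_eq_iff column_def)

text \<open>
  Each residual column is the orthogonal projection of the corresponding column of \<open>B\<close> onto the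
  complement of the span of the chosen columns. The three consequences of this that are recorded
  here, in a form that is preserved by one elimination step, are all that the pivot analysis uses.
\<close>

lemma greedy_pivots_residual:
  fixes B :: "real^'n::finite^'k::finite"
  assumes "greedy_pivots B ps A"
  shows "(\<forall>j \<in> set ps. column j A = 0) \<and>
    (\<forall>i j. norm (column i A - column j A) \<le> norm (column i B - column j B)) \<and>
    (\<forall>j. column j A - column j B \<in> span ((\<lambda>p. column p B) ` set ps))"
  using assms
proof induction
  case start
  then show ?case by (simp add: span_zero)
next
  case (step ps A p)
  let ?S = "\<lambda>ps. span ((\<lambda>p. column p B) ` set ps)"
  let ?A = "orthogonalize_columns A p"
  have zero: "column j ?A = 0" if "j \<in> set (ps @ [p])" for j
    using that step.IH by (auto simp: column_orthogonalize_columns)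
  have contr: "norm (column i ?A - column j ?A) \<le> norm (column i B - column j B)" for i j
  proof -
    have "column i ?A - column j ?A = (column i A - column j A) -
        ((column p A \<bullet> (column i A - column j A)) / (column p A \<bullet> column p A)) *\<^sub>R column p A"
      by (simp add: column_orthogonalize_columns inner_diff_right diff_divide_distrib algebra_simps)
    then have "norm (column i ?A - column j ?A) \<le> norm (column i A - column j A)"
      by (simp add: orthogonalize_against_norm_le)
    also have "\<dots> \<le> norm (column i B - column j B)"
      using step.IH by blast
    finally show ?thesis .
  qed
  have sub: "?S ps \<subseteq> ?S (ps @ [p])"
    by (intro span_mono) auto
  have "column p B \<in> ?S (ps @ [p])"
    by (intro span_base) auto
  moreover have diff: "column j A - column j B \<in> ?S (ps @ [p])" for j
    using step.IH sub by blast
  ultimately have p: "column p A \<in> ?S (ps @ [p])"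
    using span_add by (metis diff_add_cancel)
  have "column j ?A - column j B \<in> ?S (ps @ [p])" for j
  proof -
    have "column j ?A - column j B = (column j A - column j B) -
        ((column p A \<bullet> column j A) / (column p A \<bullet> column p A)) *\<^sub>R column p A"
      by (simp add: column_orthogonalize_columns)
    then show ?thesis
      using diff p span_diff span_scale by metis
  qed
  with zero contr show ?case by blast
qed

text \<open>
  Fewer than \<open>k\<close> pivots leave a direction \<open>x\<close> orthogonal to all of them. Residuals differ from the
  original columns by combinations of pivots, so their components along \<open>x\<close> are still the entries of
  \<open>V x\<close>; as \<open>V\<close> is an isometry, the largest of these \<open>n\<close> entries is at least \<open>\<parallel>x\<parallel> / sqrt n\<close>.
\<close>

lemma greedy_pivots_large_residual:
  fixes V :: "real^'k::finite^'n::finite"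
  assumes V: "transpose V ** V = mat 1"
    and g: "greedy_pivots (transpose V) ps A"
    and len: "length ps < CARD('k)"
  shows "\<exists>j. j \<notin> set ps \<and> 1 / sqrt (real CARD('n)) \<le> norm (column j A)"
proof -
  let ?S = "(\<lambda>p. column p (transpose V)) ` set ps"
  have "dim ?S < DIM(real^'k)"
  proof -
    have "dim ?S \<le> card ?S"
      by (rule dim_le_card') simp
    also have "\<dots> \<le> card (set ps)"
      by (rule card_image_le) simp
    also have "\<dots> \<le> length ps"
      by (rule card_length)
    finally show ?thesis
      using len by simp
  qed
  then obtain x where "x \<noteq> 0" and orth: "\<And>y. y \<in> span ?S \<Longrightarrow> orthogonal x y"
    using orthogonal_to_subspace_exists by blast
  let ?q = "1 / sqrt (real CARD('n))"
  obtain j where j: "?q * norm x \<le> \<bar>(V *v x) $ j\<bar>"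
  proof (rule ccontr)
    assume "\<not> thesis"
    with that have less: "\<bar>(V *v x) $ i\<bar> < ?q * norm x" for i
      by (meson not_le)
    have "(norm (V *v x))\<^sup>2 = (\<Sum>i\<in>UNIV. ((V *v x) $ i)\<^sup>2)"
      by (simp add: norm_vec_def L2_set_def sum_nonneg)
    also have "\<dots> < (\<Sum>i\<in>(UNIV::'n set). (?q * norm x)\<^sup>2)"
    proof (rule sum_strict_mono)
      fix i :: 'n
      show "((V *v x) $ i)\<^sup>2 < (?q * norm x)\<^sup>2"
        using power_strict_mono[OF less[of i] abs_ge_zero, of 2] by simp
    qed simp_all
    also have "\<dots> = (norm x)\<^sup>2"
      by (simp add: power_mult_distrib power_divide)
    finally show False
      by (simp add: norm_orthonormal_columns_mult[OF V])
  qed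
  note res = greedy_pivots_residual[OF g]
  have "x \<bullet> (column j A - column j (transpose V)) = 0"
    using res orth by (simp add: orthogonal_def)
  then have "x \<bullet> column j A = x \<bullet> column j (transpose V)"
    by (simp add: inner_diff_right)
  also have "\<dots> = (V *v x) $ j"
    by (simp add: matrix_vector_mult_def inner_vec_def column_def transpose_def mult.commute)
  finally have "?q * norm x \<le> norm (column j A) * norm x"
    using j Cauchy_Schwarz_ineq2[of x "column j A"] by (simp add: mult.commute)
  then have "?q \<le> norm (column j A)"
    using \<open>x \<noteq> 0\<close> by (metis mult_le_cancel_right_pos zero_less_norm_iff)
  moreover from this have "column j A \<noteq> 0"
    by (auto simp: not_le)
  ultimately show ?thesis
    using res by blast
qed

text \<open>
  A column in a cluster that already contains a pivot \<open>q\<close> has a residual no longer than its original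
  distance to column \<open>q\<close>, because the residual of \<open>q\<close> is zero. By the previous lemma this is too
  short to be the next pivot.
\<close>

lemma greedy_pivots_distinct_clusters:
  fixes V :: "real^'k::finite^'n::finite"
  assumes V: "transpose V ** V = mat 1"
    and close: "\<And>i j. cl i = cl j \<Longrightarrow>
      norm (column i (transpose V) - column j (transpose V)) < 1 / sqrt (real CARD('n))"
    and g: "greedy_pivots (transpose V) ps A"
    and "length ps \<le> CARD('k)"
  shows "inj_on cl (set ps)"
  using g \<open>length ps \<le> CARD('k)\<close>
proof induction
  case start
  then show ?case by simp
next
  case (step ps A p)
  obtain j where j: "j \<notin> set ps" "1 / sqrt (real CARD('n)) \<le> norm (column j A)"
    using greedy_pivots_large_residual[OF V step.hyps(1)] step.prems by auto
  then have big: "1 / sqrt (real CARD('n)) \<le> norm (column p A)"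
    using step.hyps(3) order_trans by blast
  have "cl p \<noteq> cl q" if "q \<in> set ps" for q
  proof
    assume "cl p = cl q"
    then have "norm (column p A - column q A) < 1 / sqrt (real CARD('n))"
      using close greedy_pivots_residual[OF step.hyps(1)] by (meson le_less_trans)
    then show False
      using big greedy_pivots_residual[OF step.hyps(1)] that by simp
  qed
  then have "cl p \<notin> cl ` set ps"
    by auto
  then show ?case
    using step by simp
qed

section \<open>Perturbation of the positive semidefinite square root\<close>

definition diagonal_matrix :: "('k \<Rightarrow> real) \<Rightarrow> real^'k::finite^'k" where
  "diagonal_matrix d = (\<chi> i j. if i = j then d j else 0)"

lemma diagonal_matrix_mult_nth:
  "(A ** diagonal_matrix d) $ i $ j = A $ i $ j * d j"
  by (simp add: matrix_matrix_mult_def diagonal_matrix_def if_distrib[where f="\<lambda>x. _ * x"]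
      cong: if_cong)

lemma mult_diagonal_matrix_nth:
  "(diagonal_matrix d ** A) $ i $ j = d i * A $ i $ j"
proof -
  have "(diagonal_matrix d ** A) $ i $ j = (\<Sum>k\<in>UNIV. if k = i then d i * A $ i $ j else 0)"
    unfolding matrix_matrix_mult_def diagonal_matrix_def
    by (simp only: vec_lambda_beta, intro sum.cong) auto
  then show ?thesis by simp
qed

text \<open>
  From \<open>H\<^sup>2 - D\<^sup>2 = H (H - D) + (H - D) D\<close>, column \<open>x\<close> of \<open>H - D\<close> satisfies \<open>f = H x + d\<^sub>j x\<close>. Pairing
  with \<open>x\<close> and dropping the nonnegative term \<open>x \<bullet> H x\<close> yields a Lipschitz bound for the square root
  without any spectral decomposition. It controls the quadratic term of the sharper entrywise
  identity below.
\<close>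

lemma psd_sqrt_perturbation_columns:
  fixes H :: "real^'k::finite^'k"
  assumes psd: "positive_semidefinite H" and q: "q \<le> d j"
  shows "q * norm (column j (H - diagonal_matrix d))
    \<le> norm (column j (H ** H - diagonal_matrix d ** diagonal_matrix d))"
proof -
  let ?D = "diagonal_matrix d"
  let ?x = "column j (H - ?D)" and ?f = "column j (H ** H - ?D ** ?D)"
  have "?f = H *v ?x + d j *\<^sub>R ?x"
  proof -
    have "H ** H - ?D ** ?D = H ** (H - ?D) + (H - ?D) ** ?D"
      by (simp add: matrix_diff_ldistrib matrix_diff_rdistrib)
    moreover have "column j ((H - ?D) ** ?D) = d j *\<^sub>R ?x"
      by (simp add: vec_eq_iff column_def diagonal_matrix_mult_nth mult.commute
          del: vector_minus_component)
    moreover have "column j (H ** (H - ?D)) = H *v ?x"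
      by (simp add: vec_eq_iff column_def matrix_matrix_mult_def matrix_vector_mult_def)
    moreover have "column j (X + Y) = column j X + column j Y" for X Y :: "real^'k^'k"
      by (simp add: vec_eq_iff column_def)
    ultimately show ?thesis by simp
  qed
  then have "?x \<bullet> ?f = ?x \<bullet> (H *v ?x) + d j * (norm ?x)\<^sup>2"
    by (simp add: inner_add_right power2_norm_eq_inner)
  then have "d j * (norm ?x)\<^sup>2 \<le> ?x \<bullet> ?f"
    using psd by (simp add: positive_semidefinite_def)
  also have "\<dots> \<le> norm ?x * norm ?f"
    by (rule norm_cauchy_schwarz)
  finally have le: "norm ?x * (d j * norm ?x) \<le> norm ?x * norm ?f"
    by (simp add: power2_eq_square mult_ac)
  have "q * norm ?x \<le> d j * norm ?x"
    using q by (simp add: mult_right_mono)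
  also have "\<dots> \<le> norm ?f"
  proof (cases "norm ?x = 0")
    case False
    then show ?thesis
      using le by (simp add: mult_le_cancel_left)
  qed simp
  finally show ?thesis .
qed

text \<open>
  Expansion of \<open>(D + X)\<^sup>2 - D\<^sup>2 = D X + X D + X\<^sup>2\<close> for \<open>X = H - D\<close>, entry by entry. The division by
  \<open>d\<^sub>i + d\<^sub>j\<close>, rather than by the smallest \<open>d\<close>, is what matches the weighted bound on the entries of
  the difference of projectors.
\<close>

lemma sqrt_perturbation_entries:
  fixes H :: "real^'k::finite^'k"
  assumes sym: "transpose H = H"
  shows "(d i + d j) * (H - diagonal_matrix d) $ i $ j
    = (H ** H - diagonal_matrix d ** diagonal_matrix d) $ i $ j
      - column i (H - diagonal_matrix d) \<bullet> column j (H - diagonal_matrix d)"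
proof -
  let ?D = "diagonal_matrix d"
  let ?X = "H - ?D"
  have "transpose ?X = ?X"
    using sym by (auto simp: vec_eq_iff transpose_def diagonal_matrix_def)
  then have "column i ?X = row i ?X"
    by (metis column_transpose)
  then have "column i ?X \<bullet> column j ?X = (?X ** ?X) $ i $ j"
    by (simp add: matrix_mult_dot column_def row_def inner_vec_def matrix_matrix_mult_def)
  moreover have "H ** H - ?D ** ?D = ?X ** ?X + ?D ** ?X + ?X ** ?D"
    by (simp add: matrix_diff_ldistrib matrix_diff_rdistrib)
  ultimately show ?thesis
    by (simp add: diagonal_matrix_mult_nth mult_diagonal_matrix_nth algebra_simps)
qed

section \<open>Comparison of the two projectors\<close>

text \<open>
  For projectors \<open>P\<close> and \<open>Q\<close> the difference \<open>K = P - Q\<close> satisfies \<open>K = K P + P K - K\<^sup>2\<close>. Column \<open>b\<close> of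
  \<open>P = W W\<^sup>T\<close> is \<open>d (cl b)\<close> times a unit vector, so the two linear terms carry the small weights
  \<open>d (cl a)\<close> and \<open>d (cl b)\<close>; all unweighted error is quadratic.
\<close>

lemma projector_difference_entry_bounds:
  fixes W V :: "real^'k::finite^'n::finite"
  assumes W: "scaled_cluster_matrix W cl d"
    and V: "transpose V ** V = mat 1"
    and e: "\<And>x. norm ((W ** transpose W - V ** transpose V) *v x) \<le> e * norm x"
  shows "\<bar>(W ** transpose W - V ** transpose V) $ a $ b\<bar> \<le> e"
    and "\<bar>(W ** transpose W - V ** transpose V) $ a $ b\<bar> \<le> e * (d (cl a) + d (cl b)) + e\<^sup>2"
proof -
  let ?P = "W ** transpose W" and ?Q = "V ** transpose V"
  let ?K = "?P - ?Q"
  have WW: "transpose W ** W = mat 1" and dpos: "0 < d j" for j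
  proof -
    show "transpose W ** W = mat 1"
      using W by (simp add: scaled_cluster_matrix_def)
    have "0 < 1 / sqrt (real CARD('n))"
      by simp
    then show "0 < d j"
      using W unfolding scaled_cluster_matrix_def by (meson less_le_trans)
  qed
  have comp: "\<bar>(?K *v x) $ i\<bar> \<le> e * norm x" for x i
    using component_le_norm_cart[of "?K *v x" i] e[of x] by linarith
  have "0 \<le> e"
    using e[of "axis undefined 1"] norm_ge_zero[of "?K *v axis undefined 1"]
    by (simp add: norm_axis_1 del: norm_ge_zero)
  show "\<bar>?K $ a $ b\<bar> \<le> e"
    using comp[of "axis b 1" a] by (simp add: matrix_vector_mul_component inner_axis norm_axis_1)
  have idem: "X ** transpose X ** (X ** transpose X) = X ** transpose X"
    if "transpose X ** X = mat 1" for X :: "real^'k^'n"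
    using that by (metis matrix_mul_assoc matrix_mul_rid)
  have symK: "?K $ i $ j = ?K $ j $ i" for i j
    by (simp add: matrix_matrix_mult_def transpose_def mult.commute)
  have symP: "?P $ i $ j = ?P $ j $ i" for i j
    by (simp add: matrix_matrix_mult_def transpose_def mult.commute)
  have KP: "\<bar>(?K ** ?P) $ i $ j\<bar> \<le> e * d (cl j)" for i j
  proof -
    have "norm (column (cl j) W) = 1"
    proof -
      have "column (cl j) W = W *v axis (cl j) 1"
        by (simp add: matrix_vector_mult_basis)
      then show ?thesis
        using norm_orthonormal_columns_mult[OF WW] by (simp add: norm_axis_1)
    qed
    moreover have "column j ?P = d (cl j) *\<^sub>R column (cl j) W"
      using W by (simp add: vec_eq_iff column_def scaled_cluster_matrix_def matrix_matrix_mult_def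
          transpose_def if_distrib[where f="\<lambda>x. _ * x"] mult.commute cong: if_cong)
    ultimately have "norm (column j ?P) = d (cl j)"
      using dpos[of "cl j"] by simp
    moreover have "(?K ** ?P) $ i $ j = (?K *v column j ?P) $ i"
      by (simp add: matrix_matrix_mult_def matrix_vector_mult_def column_def)
    ultimately show ?thesis
      using comp[of "column j ?P" i] by simp
  qed
  have PK: "(?P ** ?K) $ a $ b = (?K ** ?P) $ b $ a"
    unfolding matrix_matrix_mult_def[of ?P ?K] matrix_matrix_mult_def[of ?K ?P]
    using symK symP by (simp add: mult.commute)
  have KK: "\<bar>(?K ** ?K) $ a $ b\<bar> \<le> e\<^sup>2"
  proof -
    have "(?K ** ?K) $ a $ b = (?K *v (?K *v axis b 1)) $ a"
      by (simp add: matrix_vector_mul_assoc matrix_vector_mul_component inner_axis)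
    also have "\<bar>\<dots>\<bar> \<le> e * norm (?K *v axis b 1)"
      by (rule comp)
    also have "\<dots> \<le> e * e"
      using e[of "axis b 1"] \<open>0 \<le> e\<close> by (simp add: norm_axis_1 mult_left_mono)
    finally show ?thesis
      by (simp add: power2_eq_square)
  qed
  have "?K ** ?P + ?P ** ?K - ?K ** ?K = ?K"
    using idem[OF WW] idem[OF V]
    by (simp add: matrix_diff_ldistrib matrix_diff_rdistrib)
  from arg_cong[OF this, of "\<lambda>X. X $ a $ b"]
  have "(?K ** ?P) $ a $ b + (?P ** ?K) $ a $ b - (?K ** ?K) $ a $ b = ?K $ a $ b"
    by (simp only: vector_add_component vector_minus_component)
  moreover have "e * (d (cl a) + d (cl b)) = e * d (cl a) + e * d (cl b)"
    by (simp add: distrib_left)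
  ultimately show "\<bar>?K $ a $ b\<bar> \<le> e * (d (cl a) + d (cl b)) + e\<^sup>2"
    using KP[of a b] KP[of b a] PK KK by linarith
qed

text \<open>
  \<open>W W\<^sup>T\<close> annihilates \<open>e\<^sub>i - e\<^sub>j\<close> when \<open>i\<close> and \<open>j\<close> lie in the same cluster, and \<open>V\<close> is an isometry. The
  constant \<open>2\<close>, an overestimate of \<open>sqrt 2\<close>, keeps this distance below the gap \<open>1 / sqrt n\<close> as soon as \<open>\<epsilon> < 1 / (2 sqrt n)\<close>.
\<close>

lemma same_cluster_columns_close:
  fixes W V :: "real^'k::finite^'n::finite"
  assumes W: "scaled_cluster_matrix W cl d"
    and V: "transpose V ** V = mat 1"
    and e: "\<And>x. norm ((W ** transpose W - V ** transpose V) *v x) \<le> e * norm x"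
    and "cl i = cl j"
  shows "norm (column i (transpose V) - column j (transpose V)) \<le> 2 * e"
proof -
  let ?x = "axis i 1 - axis j 1 :: real^'n"
  let ?y = "column i (transpose V) - column j (transpose V)"
  have "column i (transpose W) = column j (transpose W)"
    using W \<open>cl i = cl j\<close>
    by (simp add: vec_eq_iff column_def transpose_def scaled_cluster_matrix_def)
  then have "(W ** transpose W - V ** transpose V) *v ?x = - (V *v ?y)"
    by (simp add: matrix_vector_mult_diff_distrib matrix_vector_mult_basis column_diff
        column_matrix_mult)
  then have "norm ?y \<le> e * norm ?x"
    using e[of ?x] norm_orthonormal_columns_mult[OF V, of ?y] by simp
  also have "\<dots> \<le> e * 2"
  proof (rule mult_left_mono)
    show "norm ?x \<le> 2"
      using norm_triangle_ineq4[of "axis i 1 :: real^'n" "axis j 1"] by (simp add: norm_axis_1)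
    show "0 \<le> e"
      using e[of "axis i 1"] norm_ge_zero by (metis (no_types, lifting) mult.right_neutral norm_axis_1 order_trans)
  qed
  finally show ?thesis
    by (simp add: mult.commute)
qed

section \<open>Error of the polar factor\<close>

lemma polar_factor_gram:
  assumes "polar_factorization B U H"
  shows "H ** H = transpose B ** B"
proof -
  have "transpose H = H" "transpose U ** U = mat 1" "B = U ** H"
    using assms by (auto simp: polar_factorization_def positive_semidefinite_def orthogonal_matrix)
  then show ?thesis
    by (metis matrix_mul_assoc matrix_mul_lid matrix_transpose_mul)
qed

text \<open>
  With \<open>t = d \<circ> cl \<circ> \<sigma>\<close> and \<open>D = diag t\<close>, consider \<open>X = H - D\<close> and \<open>F = H\<^sup>2 - D\<^sup>2\<close>.
  In \<open>(t\<^sub>i + t\<^sub>j) X\<^sub>i\<^sub>j = F\<^sub>i\<^sub>j - (X\<^sup>2)\<^sub>i\<^sub>j\<close> the weighted bound on \<open>F\<close> contributes exactly \<open>\<epsilon>\<close> after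
  division, while its remainder \<open>\<epsilon>\<^sup>2\<close> and \<open>X\<^sup>2\<close>, which is at most \<open>n k \<epsilon>\<^sup>2\<close> by the Lipschitz bound, are
  divided by \<open>t\<^sub>i + t\<^sub>j \<ge> 2 / sqrt n\<close>.
\<close>

lemma polar_factor_near_cluster_scaling:
  fixes W V :: "real^'k::finite^'n::finite"
  assumes W: "scaled_cluster_matrix W cl d"
    and V: "transpose V ** V = mat 1"
    and e: "\<And>x. norm ((W ** transpose W - V ** transpose V) *v x) \<le> e * norm x"
    and inj: "inj (cl \<circ> \<sigma>)"
    and polar: "polar_factorization (select_columns (transpose V) \<sigma>) U H"
  shows "\<bar>(H - diagonal_matrix (d \<circ> cl \<circ> \<sigma>)) $ i $ j\<bar>
    \<le> e + sqrt (real CARD('n)) / 2 * (1 + real CARD('n) * real CARD('k)) * e\<^sup>2"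
proof -
  let ?P = "W ** transpose W" and ?Q = "V ** transpose V"
  let ?K = "?P - ?Q"
  define t where "t = d \<circ> cl \<circ> \<sigma>"
  define n where "n = real CARD('n)"
  define m where "m = real CARD('k)"
  let ?D = "diagonal_matrix t"
  let ?X = "H - ?D" and ?F = "H ** H - ?D ** ?D"
  have psd: "positive_semidefinite H" and sym: "transpose H = H"
    using polar by (auto simp: polar_factorization_def positive_semidefinite_def)
  have n: "0 < n" and m: "0 < m"
    by (simp_all add: n_def m_def)
  have t: "1 / sqrt n \<le> t j" for j
    using W by (simp add: t_def n_def scaled_cluster_matrix_def)
  have e0: "0 \<le> e"
    using projector_difference_entry_bounds(1)[OF W V e] abs_ge_zero order_trans by blast
  \<comment> \<open>Injectivity makes the selected rows of \<open>W\<close> pairwise orthogonal, so their Gram matrix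
    is exactly \<open>D\<^sup>2\<close>; two pivots in one cluster would leave an off-diagonal entry of zeroth order.\<close>
  have FK: "?F $ i $ j = - ?K $ \<sigma> i $ \<sigma> j" for i j
  proof -
    have "(H ** H) $ i $ j = ?Q $ \<sigma> i $ \<sigma> j"
      unfolding polar_factor_gram[OF polar]
      by (simp add: select_columns_def matrix_matrix_mult_def transpose_def)
    moreover have "(?D ** ?D) $ i $ j = ?P $ \<sigma> i $ \<sigma> j"
    proof -
      have "?P $ \<sigma> i $ \<sigma> j = (if cl (\<sigma> i) = cl (\<sigma> j) then t j * t j else 0)"
        using W by (simp add: scaled_cluster_matrix_def matrix_matrix_mult_def transpose_def t_def
            if_distrib[where f="\<lambda>x. _ * x"] cong: if_cong)
      moreover have "cl (\<sigma> i) = cl (\<sigma> j) \<longleftrightarrow> i = j"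
        using inj by (metis comp_apply injD)
      ultimately show ?thesis
        by (simp only: diagonal_matrix_mult_nth) (simp add: diagonal_matrix_def)
    qed
    ultimately show ?thesis by simp
  qed
  have F1: "\<bar>?F $ i $ j\<bar> \<le> e" for i j
    using projector_difference_entry_bounds(1)[OF W V e, of "\<sigma> i" "\<sigma> j"] FK[of i j] by simp
  have F2: "\<bar>?F $ i $ j\<bar> \<le> e * (t i + t j) + e\<^sup>2" for i j
    using projector_difference_entry_bounds(2)[OF W V e, of "\<sigma> i" "\<sigma> j"] FK[of i j]
    by (simp add: t_def)
  have X: "norm (column j ?X) \<le> sqrt n * (sqrt m * e)" for j
  proof -
    have "1 / sqrt n * norm (column j ?X) \<le> norm (column j ?F)"
      by (rule psd_sqrt_perturbation_columns[where d=t and H=H, OF psd t])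
    also have "\<dots> \<le> sqrt m * e"
      unfolding m_def by (rule norm_le_sqrt_card_times) (use F1 in \<open>simp add: column_def\<close>)
    finally show ?thesis
      using n by (simp add: field_simps)
  qed
  have XX: "\<bar>column i ?X \<bullet> column j ?X\<bar> \<le> n * m * e\<^sup>2"
  proof -
    have "\<bar>column i ?X \<bullet> column j ?X\<bar> \<le> norm (column i ?X) * norm (column j ?X)"
      by (rule Cauchy_Schwarz_ineq2)
    also have "\<dots> \<le> (sqrt n * (sqrt m * e)) * (sqrt n * (sqrt m * e))"
      using X e0 n m by (intro mult_mono) auto
    also have "\<dots> = (sqrt n)\<^sup>2 * (sqrt m)\<^sup>2 * e\<^sup>2"
      by (simp add: power2_eq_square mult_ac)
    also have "\<dots> = n * m * e\<^sup>2"
      using n m by simp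
    finally show ?thesis .
  qed
  define s where "s = t i + t j"
  have s: "2 / sqrt n \<le> s"
    using t[of i] t[of j] by (simp add: s_def)
  then have s0: "0 < s"
    using n by (meson divide_pos_pos less_le_trans real_sqrt_gt_zero zero_less_numeral)
  have "s * \<bar>?X $ i $ j\<bar> = \<bar>?F $ i $ j - column i ?X \<bullet> column j ?X\<bar>"
    using sqrt_perturbation_entries[OF sym, of t i j] s0
    by (metis s_def abs_mult abs_of_pos)
  also have "\<dots> \<le> e * s + (1 + n * m) * e\<^sup>2"
    using F2[of i j] XX by (simp add: s_def algebra_simps)
  also have "\<dots> \<le> e * s + (1 + n * m) * e\<^sup>2 * (s * (sqrt n / 2))"
  proof -
    have "1 \<le> s * (sqrt n / 2)"
      using s n by (simp add: field_simps)
    moreover have "0 \<le> (1 + n * m) * e\<^sup>2"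
      using n m by simp
    ultimately show ?thesis
      using mult_left_mono by fastforce
  qed
  also have "\<dots> = s * (e + sqrt n / 2 * (1 + n * m) * e\<^sup>2)"
    by (simp add: algebra_simps)
  finally show ?thesis
    using s0 by (simp add: n_def m_def t_def)
qed

text \<open>
  Let \<open>\<Pi> = perm_matrix (cl \<circ> \<sigma>)\<close> and \<open>t = d \<circ> cl \<circ> \<sigma>\<close>. Both \<open>W W\<^sup>T\<close> and \<open>V V\<^sup>T\<close> are applied to
  the unit vector with index \<open>\<sigma> j\<close>: the former gives column \<open>j\<close> of \<open>W \<Pi>\<close> scaled by \<open>t\<^sub>j\<close>, the latter
  gives \<open>V U H e\<^sub>j\<close>, which would be \<open>t\<^sub>j\<close> times column \<open>j\<close> of \<open>V U\<close> if \<open>H\<close> were equal to \<open>diag t\<close>.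
  Division by \<open>t\<^sub>j\<close> costs the factor \<open>sqrt n\<close>.
\<close>

lemma polar_output_column_error:
  fixes W V :: "real^'k::finite^'n::finite"
  assumes W: "scaled_cluster_matrix W cl d"
    and V: "transpose V ** V = mat 1"
    and e: "\<And>x. norm ((W ** transpose W - V ** transpose V) *v x) \<le> e * norm x"
    and polar: "polar_factorization (select_columns (transpose V) \<sigma>) U H"
  shows "norm (column j (W ** perm_matrix (cl \<circ> \<sigma>) - V ** U))
    \<le> sqrt (real CARD('n)) *
       (e + norm (column j (H - diagonal_matrix (d \<circ> cl \<circ> \<sigma>))))"
proof -
  let ?K = "W ** transpose W - V ** transpose V"
  define t where "t = d \<circ> cl \<circ> \<sigma>"
  let ?X = "H - diagonal_matrix t"
  let ?c = "column j (W ** perm_matrix (cl \<circ> \<sigma>) - V ** U)"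
  have B: "select_columns (transpose V) \<sigma> = U ** H" and U: "transpose U ** U = mat 1"
    using polar by (auto simp: polar_factorization_def orthogonal_matrix)
  have t: "1 / sqrt (real CARD('n)) \<le> t j"
    using W by (simp add: t_def scaled_cluster_matrix_def)
  have D: "column j (diagonal_matrix t) = t j *\<^sub>R axis j 1"
    by (simp add: vec_eq_iff column_def diagonal_matrix_def axis_def)
  have Wp: "t j *\<^sub>R column j (W ** perm_matrix (cl \<circ> \<sigma>)) = (W ** transpose W) *v axis (\<sigma> j) 1"
  proof -
    have "column j (perm_matrix (cl \<circ> \<sigma>)) = axis (cl (\<sigma> j)) 1"
      by (simp add: vec_eq_iff column_def perm_matrix_def axis_def)
    then have "column j (W ** perm_matrix (cl \<circ> \<sigma>)) = column (cl (\<sigma> j)) W"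
      by (simp add: column_matrix_mult matrix_vector_mult_basis)
    moreover have "column (\<sigma> j) (transpose W) = t j *\<^sub>R axis (cl (\<sigma> j)) 1"
      using W by (simp add: vec_eq_iff column_def transpose_def axis_def
          scaled_cluster_matrix_def t_def)
    ultimately show ?thesis
      by (simp add: column_matrix_mult matrix_vector_mult_scaleR matrix_vector_mult_basis)
  qed
  have Vp: "(V ** transpose V) *v axis (\<sigma> j) 1 = V *v (U *v column j H)"
  proof -
    have "U *v column j H = column (\<sigma> j) (transpose V)"
      by (simp flip: column_matrix_mult B) (simp add: vec_eq_iff column_def row_def transpose_def select_columns_def)
    then show ?thesis
      by (simp add: column_matrix_mult matrix_vector_mult_basis)
  qed
  have "t j *\<^sub>R column j (V ** U) = V *v (U *v column j (diagonal_matrix t))"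
    by (simp add: D matrix_vector_mult_scaleR matrix_vector_mult_basis column_matrix_mult)
  then have "t j *\<^sub>R ?c = ?K *v axis (\<sigma> j) 1 + V *v (U *v column j ?X)"
    by (simp add: column_diff scaleR_diff_right Wp Vp matrix_vector_mult_diff_rdistrib
        matrix_vector_mult_diff_distrib)
  then have "norm (t j *\<^sub>R ?c) \<le> norm (?K *v axis (\<sigma> j) 1) + norm (V *v (U *v column j ?X))"
    by (metis norm_triangle_ineq)
  also have "\<dots> \<le> e + norm (column j ?X)"
    using e[of "axis (\<sigma> j) 1"] norm_orthonormal_columns_mult[OF V]
      norm_orthonormal_columns_mult[OF U] by (simp add: norm_axis_1)
  finally have "t j * norm ?c \<le> e + norm (column j ?X)"
    using t by (smt (verit) divide_nonneg_nonneg norm_scaleR of_nat_0_le_iff real_sqrt_ge_zero)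
  moreover have "1 / sqrt (real CARD('n)) * norm ?c \<le> t j * norm ?c"
    using t by (rule mult_right_mono) simp
  ultimately have "1 / sqrt (real CARD('n)) * norm ?c \<le> e + norm (column j ?X)"
    by linarith
  then show ?thesis
    by (simp add: t_def field_simps)
qed

theorem theorem1:
  assumes "CARD('n::{finite,linorder}) > 4"
  shows "\<exists>c::real. \<forall>(W :: real^'k::{finite,linorder}^'n::{finite,linorder})
      (V :: real^'k::{finite,linorder}^'n::{finite,linorder})
      (U :: real^'k::{finite,linorder}^'k::{finite,linorder}) (\<epsilon>::real).
    normalized_indicator_matrix W \<longrightarrow>
    transpose V ** V = mat 1 \<longrightarrow>
    spectral_norm (W ** transpose W - V ** transpose V) \<le> \<epsilon> \<longrightarrow>
    \<epsilon> < 2 powr (- real CARD('k)) / sqrt (real CARD('n)) \<longrightarrow>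
    cpqr_polar_output (transpose V) U \<longrightarrow>
    (\<exists>P :: real^'k::{finite,linorder}^'k::{finite,linorder}. permutation_matrix P \<and>
       frobenius_norm (W ** P - V ** U)
         \<le> \<epsilon> * real CARD('k) * sqrt (real CARD('n)) * (2 + 2 * sqrt 2) + c * \<epsilon>\<^sup>2)"
proof -
  define n where "n = real CARD('n)"
  define k where "k = real CARD('k)"
  define b where "b = sqrt n / 2 * (1 + n * k)"
  have n: "0 < n" and k: "1 \<le> k"
    by (simp_all add: n_def k_def Suc_le_eq)
  show ?thesis
  proof (intro exI[of _ "k * sqrt n * b"] allI impI)
    fix W V :: "real^'k::{finite,linorder}^'n::{finite,linorder}"
      and U :: "real^'k::{finite,linorder}^'k::{finite,linorder}" and \<epsilon> :: real
    assume ind: "normalized_indicator_matrix W" and V: "transpose V ** V = mat 1"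
      and sp: "spectral_norm (W ** transpose W - V ** transpose V) \<le> \<epsilon>"
      and small: "\<epsilon> < 2 powr (- real CARD('k)) / sqrt (real CARD('n))"
      and out: "cpqr_polar_output (transpose V) U"
    obtain cl d where W: "scaled_cluster_matrix W cl d"
      using normalized_indicator_matrix_clusters[OF ind] .
    note K = spectral_norm_bound[OF sp]
    have e0: "0 \<le> \<epsilon>"
      using projector_difference_entry_bounds(1)[OF W V K] abs_ge_zero order_trans by blast
    \<comment> \<open>Since \<open>k \<ge> 1\<close>, the hypothesis on \<open>\<epsilon>\<close> puts \<open>2 \<epsilon>\<close> below the gap \<open>1 / sqrt n\<close>.\<close>
    have "2 powr (- k) \<le> (2::real) powr (-1)"
      using k by (intro powr_mono) auto
    then have "2 powr (- k) / sqrt n \<le> (1/2) / sqrt n"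
      using n by (intro divide_right_mono) (auto simp: powr_minus)
    then have small2: "2 * \<epsilon> < 1 / sqrt n"
      using small by (simp add: n_def k_def)
    obtain \<pi> Q R \<sigma> H where cpqr: "cpqr (transpose V) \<pi> Q R"
      and \<sigma>: "bij_betw \<sigma> (UNIV :: 'k set) (\<pi> ` set (take CARD('k) index_list))"
      and polar: "polar_factorization (select_columns (transpose V) \<sigma>) U H"
      using out unfolding cpqr_polar_output_def by blast
    obtain A where g: "greedy_pivots (transpose V) (map \<pi> (take CARD('k) index_list)) A"
      using cpqr unfolding cpqr_def by blast
    have "inj_on cl (set (map \<pi> (take CARD('k) index_list)))"
    proof (rule greedy_pivots_distinct_clusters[OF V _ g])
      show "norm (column i (transpose V) - column j (transpose V)) < 1 / sqrt (real CARD('n))"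
        if "cl i = cl j" for i j
        using same_cluster_columns_close[OF W V K that] small2 by (simp add: n_def)
    qed simp
    then have inj: "inj (cl \<circ> \<sigma>)"
      using \<sigma> by (simp add: bij_betw_def comp_inj_on)
    let ?X = "H - diagonal_matrix (d \<circ> cl \<circ> \<sigma>)"
    let ?E = "W ** perm_matrix (cl \<circ> \<sigma>) - V ** U"
    have X: "norm (column j ?X) \<le> sqrt k * (\<epsilon> + b * \<epsilon>\<^sup>2)" for j
      unfolding k_def
    proof (rule norm_le_sqrt_card_times)
      show "\<bar>column j ?X $ i\<bar> \<le> \<epsilon> + b * \<epsilon>\<^sup>2" for i
        using polar_factor_near_cluster_scaling[OF W V K inj polar, of i j]
        by (simp add: column_def b_def n_def k_def)
    qed
    have "frobenius_norm ?E \<le> sqrt k * (sqrt n * (\<epsilon> + sqrt k * (\<epsilon> + b * \<epsilon>\<^sup>2)))"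
      unfolding k_def
    proof (rule frobenius_norm_le_of_columns)
      fix j
      have "norm (column j ?E) \<le> sqrt n * (\<epsilon> + norm (column j ?X))"
        using polar_output_column_error[OF W V K polar] by (simp add: n_def)
      also have "\<dots> \<le> sqrt n * (\<epsilon> + sqrt k * (\<epsilon> + b * \<epsilon>\<^sup>2))"
        using X n by simp
      finally show "norm (column j ?E)
          \<le> sqrt n * (\<epsilon> + sqrt (real CARD('k)) * (\<epsilon> + b * \<epsilon>\<^sup>2))"
        by (simp add: k_def)
    qed
    also have "\<dots> = sqrt n * (\<epsilon> * sqrt k + (sqrt k)\<^sup>2 * (\<epsilon> + b * \<epsilon>\<^sup>2))"
      by (simp only: algebra_simps power2_eq_square)
    also have "\<dots> = sqrt n * (\<epsilon> * sqrt k + k * (\<epsilon> + b * \<epsilon>\<^sup>2))"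
      using k by simp
    also have "\<dots> \<le> sqrt n * (\<epsilon> * k + k * (\<epsilon> + b * \<epsilon>\<^sup>2))"
    proof -
      \<comment> \<open>The contribution of \<open>K e\<close> is only of order \<open>sqrt k\<close> and is rounded up to the order of the
      contribution of \<open>H - D\<close>.\<close>
    have "sqrt k \<le> k"
        using k real_le_lsqrt[of k k] by (simp add: power2_eq_square)
      then show ?thesis
        using n e0 by (simp add: mult_left_mono)
    qed
    also have "\<dots> = \<epsilon> * k * sqrt n * 2 + k * sqrt n * b * \<epsilon>\<^sup>2"
      by (simp add: algebra_simps)
    also have "\<dots> \<le> \<epsilon> * k * sqrt n * (2 + 2 * sqrt 2) + k * sqrt n * b * \<epsilon>\<^sup>2"
      using n k e0 by (intro add_right_mono mult_left_mono) auto
    finally have "frobenius_norm ?E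
        \<le> \<epsilon> * k * sqrt n * (2 + 2 * sqrt 2) + k * sqrt n * b * \<epsilon>\<^sup>2" .
    moreover have "permutation_matrix (perm_matrix (cl \<circ> \<sigma>) :: real^'k::{finite,linorder}^'k::{finite,linorder})"
      using inj finite_UNIV_inj_surj[OF finite inj]
      unfolding permutation_matrix_def bij_def by blast
    ultimately show "\<exists>P :: real^'k::{finite,linorder}^'k::{finite,linorder}. permutation_matrix P \<and> frobenius_norm (W ** P - V ** U)
        \<le> \<epsilon> * real CARD('k) * sqrt (real CARD('n)) * (2 + 2 * sqrt 2) + k * sqrt n * b * \<epsilon>\<^sup>2"
      by (auto simp: n_def k_def)
  qed
qed

end
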